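(* Let $S$ be a $p\times p$ positive semidefinite matrix and let $\mathrm{pen}_D=0$. If $$\liminf_{|x|\to\infty}\frac{\mathrm{pen}(x)}{\log|x|}>p-1,$$ then the penalised likelihood estimate $\hat\Theta_{\mathrm{Pen}}$ exists if and only if all diagonal entries of $S$ are strictly positive.
   Context: Fix an integer $p\ge 1$. All matrices are real symmetric $p\times p$; $\Theta=(\theta_{ij})\succ 0$ means $\Theta$ is positive definite. The off-diagonal penalty $\mathrm{pen}:\mathbb{R}\to\mathbb{R}$ is non-negative, symmetric around $0$, non-decreasing in $|x|$ and continuous, and $\mathrm{pen}_D:(0,\infty)\to\mathbb{R}$ denotes the diagonal penalty. Define $$\mathrm{Pen}(\Theta)=\sum_{i=1}^p \mathrm{pen}_D(\theta_{ii})+\sum_{i<j}\mathrm{pen}(\theta_{ij}),\qquad l_{\mathrm{Pen}}(\Theta\mid S)=\log\det\Theta-\mathrm{tr}(S\Theta)-\mathrm{Pen}(\Theta),\quad \Theta\succ 0.$$ The penalised likelihood estimate is $\hat\Theta_{\mathrm{Pen}}=\mathrm{argmax}_{\Theta\succ 0}\, l_{\mathrm{Pen}}(\Theta\mid S)$; it is said to exist if the supremum of $l_{\mathrm{Pen}}(\cdot\mid S)$ over positive definite $\Theta$ is finite and attained. *)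

theory Defs
  imports "HOL-Analysis.Analysis"
begin

definition symmetric_matrix :: "real^'n^'n \<Rightarrow> bool" where
  "symmetric_matrix A \<longleftrightarrow> transpose A = A"

definition pos_def :: "real^'n^'n \<Rightarrow> bool" where
  "pos_def A \<longleftrightarrow> symmetric_matrix A \<and> (\<forall>x. x \<noteq> 0 \<longrightarrow> x \<bullet> (A *v x) > 0)"

definition pos_semidef :: "real^'n^'n \<Rightarrow> bool" where
  "pos_semidef A \<longleftrightarrow> symmetric_matrix A \<and> (\<forall>x. x \<bullet> (A *v x) \<ge> 0)"

definition offdiag_penalty :: "(real \<Rightarrow> real) \<Rightarrow> bool" where
  "offdiag_penalty pen \<longleftrightarrow>
     (\<forall>x. pen x \<ge> 0) \<and>
     (\<forall>x. pen (- x) = pen x) \<and>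
     (\<forall>x y. \<bar>x\<bar> \<le> \<bar>y\<bar> \<longrightarrow> pen x \<le> pen y) \<and>
     continuous_on UNIV pen"

(* The dimension p is CARD('n). The linear order on the index type is only used to
   select each unordered pair of distinct indices exactly once. The diagonal penalty
   is a total function here, but on positive definite matrices it is evaluated only
   at positive arguments. *)

definition Pen ::
  "(real \<Rightarrow> real) \<Rightarrow> (real \<Rightarrow> real) \<Rightarrow> real^'n::{finite,linorder}^'n::{finite,linorder} \<Rightarrow> real" where
  "Pen penD pen \<Theta> =
     (\<Sum>i\<in>UNIV. penD (\<Theta> $ i $ i)) + (\<Sum>(i, j) | i < j. pen (\<Theta> $ i $ j))"

definition l_Pen ::
  "(real \<Rightarrow> real) \<Rightarrow> (real \<Rightarrow> real) \<Rightarrow> real^'n::{finite,linorder}^'n::{finite,linorder}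
   \<Rightarrow> real^'n::{finite,linorder}^'n::{finite,linorder} \<Rightarrow> real" where
  "l_Pen penD pen S \<Theta> = ln (det \<Theta>) - trace (S ** \<Theta>) - Pen penD pen \<Theta>"

(* Boundedness is needed explicitly: the real-valued supremum of an unbounded set
   is an unspecified number. Uniqueness of the maximiser is not part of existence. *)

definition penalised_estimate_exists ::
  "(real \<Rightarrow> real) \<Rightarrow> (real \<Rightarrow> real) \<Rightarrow> real^'n::{finite,linorder}^'n::{finite,linorder} \<Rightarrow> bool" where
  "penalised_estimate_exists penD pen S \<longleftrightarrow>
     bdd_above (l_Pen penD pen S ` {\<Theta>. pos_def \<Theta>}) \<and>
     (\<exists>\<Theta>. pos_def \<Theta> \<and>
        l_Pen penD pen S \<Theta> = (SUP \<Theta>'\<in>{\<Theta>. pos_def \<Theta>}. l_Pen penD pen S \<Theta>'))"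

end

theory Submission
  imports Defs "HOL-Real_Asymp.Real_Asymp"
begin

text \<open>
  The point is that \<open>l\<close> tends to minus infinity as the largest diagonal entry \<open>t\<close> of \<open>\<Theta>\<close> grows.
  If all off-diagonal entries are at most \<open>\<epsilon>t\<close>, then \<open>tr(S\<Theta>)\<close> is at least a positive multiple of
  \<open>t\<close>, which beats \<open>log det \<Theta> \<le> p log t\<close>. Otherwise the penalty is at least \<open>c log(\<epsilon>t)\<close> with
  \<open>c > p - 1\<close>, and it suffices to save one factor \<open>t\<close> in the determinant. Let \<open>s\<close> be the \<open>i\<close>-th column
  of \<open>S\<close> and \<open>q = s\<^sup>T\<Theta>s\<close>. Hadamard's inequality in the basis where \<open>s\<close> replaces the \<open>i\<close>-th unit
  vector bounds \<open>s\<^sub>i\<^sup>2 det \<Theta>\<close> by \<open>q\<close> times the \<open>(p - 1)\<close>-st power of \<open>t\<close>, whereas the Cauchy-Schwarz inequality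
  for \<open>S\<close> gives \<open>tr(S\<Theta>) \<ge> q / S\<^sub>i\<^sub>i\<close>, so that \<open>log q - tr(S\<Theta>)\<close> is bounded.
  A superlevel set of \<open>l\<close> is thus bounded, and it is closed because \<open>det \<Theta>\<close> stays away from \<open>0\<close> on it.
  Conversely, if \<open>S\<^sub>i\<^sub>i = 0\<close>, then \<open>l\<close> is unbounded on diagonal matrices.
\<close>

section \<open>Quadratic forms and positive definiteness\<close>

lemma quadratic_form_congruence:
  fixes G M :: "real^'n^'n"
  shows "x \<bullet> ((transpose G ** M ** G) *v x) = (G *v x) \<bullet> (M *v (G *v x))"
proof -
  have "x \<bullet> ((transpose G ** M ** G) *v x) = x \<bullet> ((M *v (G *v x)) v* G)"
    by (simp add: matrix_vector_mul_assoc[symmetric] matrix_mul_assoc[symmetric])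
  also have "\<dots> = (G *v x) \<bullet> (M *v (G *v x))"
    by (subst inner_commute, subst dot_lmul_matrix, rule inner_commute)
  finally show ?thesis .
qed

lemma quadratic_form_axis:
  fixes M :: "real^'n^'n"
  shows "axis k 1 \<bullet> (M *v axis k 1) = M $ k $ k"
  by (simp add: matrix_vector_mult_basis inner_axis' column_def)

lemma congruence_diagonal:
  fixes G M :: "real^'n^'n"
  shows "(transpose G ** M ** G) $ k $ k = column k G \<bullet> (M *v column k G)"
  using quadratic_form_congruence[of "axis k 1" G M]
  by (metis quadratic_form_axis matrix_vector_mult_basis)

lemma pos_def_imp_pos_semidef: "pos_def A \<Longrightarrow> pos_semidef A"
  unfolding pos_def_def pos_semidef_def by (metis inner_zero_left less_eq_real_def)

lemma pos_def_diagonal: "pos_def A \<Longrightarrow> 0 < A $ k $ k"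
  unfolding pos_def_def quadratic_form_axis[of k A, symmetric] by (simp add: axis_eq_0_iff)

lemma pos_semidef_diagonal: "pos_semidef A \<Longrightarrow> 0 \<le> A $ k $ k"
  unfolding pos_semidef_def quadratic_form_axis[of k A, symmetric] by blast

lemma symmetric_matrix_nth: "symmetric_matrix A \<Longrightarrow> A $ i $ j = A $ j $ i"
  unfolding symmetric_matrix_def by (metis transpose_def vec_lambda_beta)

lemma symmetric_matrix_inner:
  fixes A :: "real^'n^'n"
  shows "symmetric_matrix A \<Longrightarrow> x \<bullet> (A *v y) = y \<bullet> (A *v x)"
  unfolding symmetric_matrix_def
  using dot_lmul_matrix[of x A y] transpose_matrix_vector[of A x] by (simp add: inner_commute)

text \<open>The form at \<open>x + t *\<^sub>R y\<close> is a polynomial of degree at most two in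
  \<open>t\<close> that is never negative; if \<open>c > 0\<close>, its value at the minimiser
  \<open>- b / c\<close> gives the inequality.\<close>

lemma pos_semidef_Cauchy_Schwarz:
  fixes A :: "real^'n^'n"
  assumes "pos_semidef A"
  shows "(x \<bullet> (A *v y))\<^sup>2 \<le> (x \<bullet> (A *v x)) * (y \<bullet> (A *v y))"
proof -
  define a b c where "a = x \<bullet> (A *v x)" and "b = x \<bullet> (A *v y)" and "c = y \<bullet> (A *v y)"
  have sym: "y \<bullet> (A *v x) = b"
    using assms symmetric_matrix_inner unfolding pos_semidef_def b_def by metis
  have q: "0 \<le> a + 2 * t * b + t\<^sup>2 * c" for t
  proof -
    have "0 \<le> (x + t *\<^sub>R y) \<bullet> (A *v (x + t *\<^sub>R y))"
      using assms unfolding pos_semidef_def by blast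
    also have "\<dots> = a + 2 * t * b + t\<^sup>2 * c"
      by (simp add: matrix_vector_right_distrib matrix_vector_mult_scaleR inner_add_left
          inner_add_right a_def[symmetric] b_def[symmetric] c_def[symmetric] sym power2_eq_square
          algebra_simps)
    finally show ?thesis .
  qed
  have c: "0 \<le> c" using assms unfolding pos_semidef_def c_def by blast
  show ?thesis
  proof (cases "c = 0")
    case True
    have "b = 0"
    proof (rule ccontr)
      assume "b \<noteq> 0"
      \<comment> \<open>With \<open>c = 0\<close> the polynomial is affine in \<open>t\<close>, and
        it takes the value -1 here.\<close>
      then show False using q[of "- (a + 1) / (2 * b)"] True by (simp add: field_simps)
    qed
    then show ?thesis using True unfolding a_def b_def c_def by simp
  next
    case False
    then have "0 < c" using c by simp
    then have "0 \<le> a - b\<^sup>2 / c"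
      using q[of "- b / c"] by (simp add: field_simps power2_eq_square)
    then show ?thesis using \<open>0 < c\<close>
      unfolding a_def[symmetric] b_def[symmetric] c_def[symmetric]
      by (simp add: field_simps)
  qed
qed

lemma pos_def_congruence:
  fixes G M :: "real^'n^'n"
  assumes "pos_def M" and "det G \<noteq> 0"
  shows "pos_def (transpose G ** M ** G)"
proof -
  have "inj ((*v) G)"
    using assms(2) by (simp add: inj_matrix_vector_mult invertible_det_nz)
  then have "G *v x \<noteq> 0" if "x \<noteq> 0" for x
    using that by (metis injD matrix_vector_mult_0_right)
  then show ?thesis
    using assms(1) unfolding pos_def_def quadratic_form_congruence symmetric_matrix_def
    by (simp add: matrix_transpose_mul matrix_mul_assoc)
qed

text \<open>A vector on which a positive semidefinite form vanishes lies in the kernel, by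
  Cauchy-Schwarz for \<open>A *v x\<close> and \<open>x\<close>. This lets closed conditions stand
  in for positive definiteness in the compactness argument.\<close>

lemma pos_semidef_imp_pos_def:
  fixes A :: "real^'n^'n"
  assumes "pos_semidef A" and "det A \<noteq> 0"
  shows "pos_def A"
proof -
  have "0 < x \<bullet> (A *v x)" if "x \<noteq> 0" for x
  proof (rule ccontr)
    assume "\<not> 0 < x \<bullet> (A *v x)"
    then have "x \<bullet> (A *v x) = 0"
      using assms(1) unfolding pos_semidef_def by (metis less_eq_real_def)
    then have "(A *v x) \<bullet> (A *v x) = 0"
      using pos_semidef_Cauchy_Schwarz[OF assms(1), of "A *v x" x] by simp
    then have "A *v x = A *v 0" by simp
    moreover have "inj ((*v) A)"
      using assms(2) by (simp add: inj_matrix_vector_mult invertible_det_nz)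
    ultimately show False using that by (metis injD)
  qed
  then show ?thesis using assms(1) unfolding pos_def_def pos_semidef_def by blast
qed

section \<open>Symmetric elimination and Hadamard's inequality\<close>

lemma det_mat_1_replace_column:
  fixes x :: "real^'n"
  shows "det ((\<chi> a b. if b = k then x $ a else mat 1 $ a $ b) :: real^'n^'n) = x $ k"
  \<comment> \<open>Cramer's rule for the linear system with the identity matrix.\<close>
  using cramer_lemma[of k "mat 1 :: real^'n^'n" x] by (simp only: matrix_vector_mul_lid det_I mult_1_right)

text \<open>One step of symmetric Gaussian elimination: row and column \<open>i\<close> of \<open>A\<close> are cleared.\<close>

lemma pos_def_eliminate:
  fixes A :: "real^'n^'n"
  assumes A: "pos_def A"
  obtains F B :: "real^'n^'n"
  where "det F = 1" "pos_def B" "A = F ** B ** transpose F"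
    "\<And>a b. B $ a $ b = (if a = i \<and> b = i then A $ i $ i else A $ a $ b - A $ a $ i * A $ i $ b / A $ i $ i)"
proof -
  let ?p = "A $ i $ i"
  have p: "0 < ?p" using pos_def_diagonal[OF A] .
  have sA: "A $ a $ b = A $ b $ a" for a b
    using A symmetric_matrix_nth unfolding pos_def_def by metis
  define F :: "real^'n^'n" where "F = (\<chi> a b. if b = i then (\<chi> a. A $ a $ i / ?p) $ a else mat 1 $ a $ b)"
  define B :: "real^'n^'n" where
    "B = (\<chi> a b. if a = i \<and> b = i then ?p else A $ a $ b - A $ a $ i * A $ i $ b / ?p)"
  have dF: "det F = 1"
    unfolding F_def det_mat_1_replace_column using p by simp
  \<comment> \<open>\<open>F\<close> is the identity plus a rank-one matrix supported on column
    \<open>i\<close>, where it equals \<open>u\<close>; a product with \<open>F\<close> therefore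
    adds a single term to each entry.\<close>
  define u where "u a = A $ a $ i / ?p - (if a = i then 1 else 0)" for a
  have Fu: "F $ a $ b = (if a = b then 1 else 0) + (if b = i then u a else 0)" for a b
    by (simp add: F_def mat_def u_def)
  have Bi: "B $ a $ i = (if a = i then ?p else 0)" "B $ i $ a = (if a = i then ?p else 0)" for a
    using p by (auto simp: B_def)
  have BF: "(B ** transpose F) $ c $ b = B $ c $ b + B $ c $ i * u b" for c b
    by (simp add: matrix_matrix_mult_def transpose_def Fu distrib_left sum.distrib
        if_distrib[of "\<lambda>x. _ * x"] cong: if_cong)
  have FX: "(F ** X) $ a $ b = X $ a $ b + u a * X $ i $ b" for X :: "real^'n^'n" and a b
    by (simp add: matrix_matrix_mult_def Fu distrib_right sum.distrib
        if_distrib[of "\<lambda>x. x * _"] cong: if_cong)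
  have "(F ** B ** transpose F) $ a $ b = A $ a $ b" for a b
    unfolding matrix_mul_assoc[symmetric] FX BF Bi
    using p by (auto simp: B_def u_def sA field_simps)
  then have AF: "A = F ** B ** transpose F" by (simp add: vec_eq_iff)
  have sB: "symmetric_matrix B"
    unfolding symmetric_matrix_def by (auto simp: B_def transpose_def vec_eq_iff sA)
  \<comment> \<open>Every \<open>x\<close> is of the form \<open>transpose F *v y\<close>, and there
    the form of \<open>B\<close> has the value of the form of \<open>A\<close> at
    \<open>y\<close>.\<close>
  have "0 < x \<bullet> (B *v x)" if "x \<noteq> 0" for x
  proof -
    have "invertible (transpose F)" using dF by (simp add: invertible_det_nz)
    then obtain F' :: "real^'n^'n" where "transpose F ** F' = mat 1"
      unfolding invertible_def by blast
    then have "x = transpose F *v (F' *v x)" by (simp add: matrix_vector_mul_assoc)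
    then obtain y where y: "x = transpose F *v y" by blast
    then have "y \<noteq> 0" using that by auto
    then have "0 < y \<bullet> (A *v y)" using A unfolding pos_def_def by blast
    also have "\<dots> = x \<bullet> (B *v x)"
      using quadratic_form_congruence[of y "transpose F" B] by (simp add: AF y)
    finally show ?thesis .
  qed
  then have "pos_def B" using sB unfolding pos_def_def by blast
  then show ?thesis using that[of F B] dF AF by (simp add: B_def)
qed

text \<open>Induction on the number of rows with a nonzero off-diagonal entry: eliminating such a
  row clears it off the diagonal and spoils no row that was already clear. The rows are taken in
  arbitrary order, so \<open>G\<close> need not be triangular; its determinant and the bound on the
  pivots are what matters.\<close>

lemma pos_def_LDL:
  fixes A :: "real^'n^'n"
  assumes "pos_def A"
  shows "\<exists>G D :: real^'n^'n. det G = 1 \<and> A = G ** D ** transpose G \<and>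
    (\<forall>i j. i \<noteq> j \<longrightarrow> D $ i $ j = 0) \<and> (\<forall>k. 0 < D $ k $ k \<and> D $ k $ k \<le> A $ k $ k)"
  using assms
proof (induction "card {i. \<exists>j. j \<noteq> i \<and> A $ i $ j \<noteq> 0}" arbitrary: A rule: less_induct)
  case (less A)
  let ?F = "\<lambda>A :: real^'n^'n. {i. \<exists>j. j \<noteq> i \<and> A $ i $ j \<noteq> 0}"
  show ?case
  proof (cases "?F A = {}")
    case True
    then have off: "\<forall>i j. i \<noteq> j \<longrightarrow> A $ i $ j = 0" by (metis (mono_tags, lifting) empty_Collect_eq)
    show ?thesis
      by (rule exI[of _ "mat 1"], rule exI[of _ A])
        (simp add: off pos_def_diagonal[OF less.prems])
  next
    case False
    then obtain i j where ij: "j \<noteq> i" "A $ i $ j \<noteq> 0" by blast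
    obtain F B :: "real^'n^'n" where dF: "det F = 1" and B: "pos_def B"
      and AF: "A = F ** B ** transpose F"
      and Bn: "\<And>a b. B $ a $ b = (if a = i \<and> b = i then A $ i $ i else A $ a $ b - A $ a $ i * A $ i $ b / A $ i $ i)"
      using pos_def_eliminate[OF less.prems, of i] by blast
    have p: "0 < A $ i $ i" using pos_def_diagonal[OF less.prems] .
    have sA: "A $ a $ b = A $ b $ a" for a b
      using less.prems symmetric_matrix_nth unfolding pos_def_def by metis
    have "?F B \<subseteq> ?F A - {i}"
    proof
      fix a assume "a \<in> ?F B"
      then obtain b where b: "b \<noteq> a" "B $ a $ b \<noteq> 0" by blast
      have "a \<noteq> i" using b p by (auto simp: Bn)
      moreover have "A $ a $ b \<noteq> 0 \<or> A $ a $ i \<noteq> 0" using b by (auto simp: Bn split: if_splits)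
      ultimately show "a \<in> ?F A - {i}" using b by auto
    qed
    moreover have "i \<in> ?F A" using ij by blast
    ultimately have "?F B \<subset> ?F A" by blast
    then have "card (?F B) < card (?F A)" by (intro psubset_card_mono) auto
    from less.hyps[OF this B] obtain G D :: "real^'n^'n" where G: "det G = 1"
      "B = G ** D ** transpose G" "\<forall>i j. i \<noteq> j \<longrightarrow> D $ i $ j = 0"
      "\<forall>k. 0 < D $ k $ k \<and> D $ k $ k \<le> B $ k $ k" by metis
    \<comment> \<open>Elimination subtracts \<open>(A $ k $ i)\<^sup>2 / A $ i $ i\<close> from
      every diagonal entry except the pivot.\<close>
    have "B $ k $ k \<le> A $ k $ k" for k
      using p by (auto simp: Bn sA)
    then have "\<forall>k. 0 < D $ k $ k \<and> D $ k $ k \<le> A $ k $ k"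
      using G(4) by (meson order_trans)
    moreover have "A = (F ** G) ** D ** transpose (F ** G)"
      by (simp add: AF G(2) matrix_transpose_mul matrix_mul_assoc)
    moreover have "det (F ** G) = 1" by (simp add: det_mul dF G(1))
    ultimately show ?thesis using G(3) by metis
  qed
qed

lemma pos_def_det_pos:
  fixes A :: "real^'n^'n"
  assumes "pos_def A"
  shows "0 < det A"
proof -
  obtain G D :: "real^'n^'n" where "det G = 1" "A = G ** D ** transpose G"
    "\<And>i j. i \<noteq> j \<Longrightarrow> D $ i $ j = 0" "\<And>k. 0 < D $ k $ k"
    using pos_def_LDL[OF assms] by metis
  then show ?thesis by (simp add: det_mul det_diagonal prod_pos)
qed

lemma pos_def_Hadamard:
  fixes A :: "real^'n^'n"
  assumes "pos_def A"
  shows "det A \<le> (\<Prod>k\<in>UNIV. A $ k $ k)"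
proof -
  obtain G D :: "real^'n^'n" where "det G = 1" "A = G ** D ** transpose G"
    "\<And>i j. i \<noteq> j \<Longrightarrow> D $ i $ j = 0" and D: "\<And>k. 0 < D $ k $ k \<and> D $ k $ k \<le> A $ k $ k"
    using pos_def_LDL[OF assms] by metis
  then have "det A = (\<Prod>k\<in>UNIV. D $ k $ k)" by (simp add: det_mul det_diagonal)
  also have "\<dots> \<le> (\<Prod>k\<in>UNIV. A $ k $ k)"
    using D by (intro prod_mono) (auto intro: less_imp_le)
  finally show ?thesis .
qed

text \<open>Hadamard's inequality after replacing the \<open>i\<close>-th basis vector by \<open>s\<close>.\<close>

lemma pos_def_det_le_replace:
  fixes A :: "real^'n^'n"
  assumes A: "pos_def A" and s: "s $ i \<noteq> 0"
  shows "(s $ i)\<^sup>2 * det A \<le> (s \<bullet> (A *v s)) * (\<Prod>k\<in>UNIV - {i}. A $ k $ k)"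
proof -
  define G :: "real^'n^'n" where "G = (\<chi> a b. if b = i then s $ a else mat 1 $ a $ b)"
  have dG: "det G = s $ i" unfolding G_def by (rule det_mat_1_replace_column)
  have col: "column k G = (if k = i then s else axis k 1)" for k
    by (auto simp: column_def G_def mat_def axis_def vec_eq_iff)
  \<comment> \<open>In the new basis the form has determinant
    \<open>(s $ i)\<^sup>2 * det A\<close>, and only the \<open>i\<close>-th diagonal entry can
    differ from that of \<open>A\<close>.\<close>
  have "pos_def (transpose G ** A ** G)" using pos_def_congruence[OF A] dG s by simp
  from pos_def_Hadamard[OF this]
  have "(s $ i)\<^sup>2 * det A \<le> (\<Prod>k\<in>UNIV. column k G \<bullet> (A *v column k G))"
    by (simp add: det_mul dG power2_eq_square congruence_diagonal mult_ac)
  also have "\<dots> = (s \<bullet> (A *v s)) * (\<Prod>k\<in>UNIV - {i}. column k G \<bullet> (A *v column k G))"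
    by (subst prod.remove[of _ i]) (auto simp: col)
  also have "(\<Prod>k\<in>UNIV - {i}. column k G \<bullet> (A *v column k G)) = (\<Prod>k\<in>UNIV - {i}. A $ k $ k)"
    by (intro prod.cong) (auto simp: col quadratic_form_axis)
  finally show ?thesis .
qed

section \<open>Lower bounds for the trace\<close>

lemma trace_mult_diagonal:
  fixes M D :: "real^'n^'n"
  assumes "\<And>i j. i \<noteq> j \<Longrightarrow> D $ i $ j = 0"
  shows "trace (M ** D) = (\<Sum>k\<in>UNIV. M $ k $ k * D $ k $ k)"
proof -
  have "(M ** D) $ k $ k = M $ k $ k * D $ k $ k" for k
  proof -
    have "(M ** D) $ k $ k = (\<Sum>j\<in>UNIV. M $ k $ j * D $ j $ k)" by (simp add: matrix_matrix_mult_def)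
    also have "\<dots> = (\<Sum>j\<in>UNIV. if j = k then M $ k $ k * D $ k $ k else 0)"
      using assms by (intro sum.cong) auto
    finally show ?thesis by simp
  qed
  then show ?thesis by (simp add: trace_def)
qed

lemma inner_diagonal:
  fixes D :: "real^'n^'n"
  assumes "\<And>i j. i \<noteq> j \<Longrightarrow> D $ i $ j = 0"
  shows "x \<bullet> (D *v x) = (\<Sum>k\<in>UNIV. (x $ k)\<^sup>2 * D $ k $ k)"
proof -
  have "(D *v x) $ k = D $ k $ k * x $ k" for k
  proof -
    have "(D *v x) $ k = (\<Sum>j\<in>UNIV. D $ k $ j * x $ j)" by (simp add: matrix_vector_mult_def)
    also have "\<dots> = (\<Sum>j\<in>UNIV. if j = k then D $ k $ k * x $ k else 0)"
      using assms by (intro sum.cong) auto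
    finally show ?thesis by simp
  qed
  then show ?thesis by (simp add: inner_vec_def power2_eq_square mult_ac)
qed

text \<open>With \<open>A = G ** D ** transpose G\<close> both sides become sums over the columns of
  \<open>G\<close> with the positive weights \<open>D $ k $ k\<close>. They are compared term by
  term, by Cauchy-Schwarz for \<open>S\<close> between a column of \<open>G\<close> and the
  \<open>i\<close>-th unit vector.\<close>

lemma trace_mult_ge_column:
  fixes S A :: "real^'n^'n"
  assumes S: "pos_semidef S" and A: "pos_def A" and i: "0 < S $ i $ i"
  shows "(column i S \<bullet> (A *v column i S)) / S $ i $ i \<le> trace (S ** A)"
proof -
  obtain G D :: "real^'n^'n" where AG: "A = G ** D ** transpose G"
    and D0: "\<And>i j. i \<noteq> j \<Longrightarrow> D $ i $ j = 0" and D: "\<And>k. 0 < D $ k $ k"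
    using pos_def_LDL[OF A] by metis
  let ?s = "column i S"
  have Gs: "(transpose G *v x) $ k = column k G \<bullet> x" for k x
    by (simp only: matrix_vector_mul_component row_transpose[unfolded row_def vec_lambda_eta])
  have "?s \<bullet> (A *v ?s) = (transpose G *v ?s) \<bullet> (D *v (transpose G *v ?s))"
    using quadratic_form_congruence[of ?s "transpose G" D] by (simp add: AG)
  also have "\<dots> = (\<Sum>k\<in>UNIV. (column k G \<bullet> ?s)\<^sup>2 * D $ k $ k)"
    by (simp add: inner_diagonal[OF D0] Gs del: transpose_matrix_vector)
  also have "\<dots> / S $ i $ i = (\<Sum>k\<in>UNIV. (column k G \<bullet> ?s)\<^sup>2 / S $ i $ i * D $ k $ k)"
    by (simp add: sum_divide_distrib)
  also have "\<dots> \<le> (\<Sum>k\<in>UNIV. (column k G \<bullet> (S *v column k G)) * D $ k $ k)"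
  proof (intro sum_mono mult_right_mono)
    fix k
    have "(column k G \<bullet> ?s)\<^sup>2 \<le> (column k G \<bullet> (S *v column k G)) * S $ i $ i"
      using pos_semidef_Cauchy_Schwarz[OF S, of "column k G" "axis i 1"]
      by (simp only: quadratic_form_axis) (simp add: matrix_vector_mult_basis)
    then show "(column k G \<bullet> ?s)\<^sup>2 / S $ i $ i \<le> column k G \<bullet> (S *v column k G)"
      using i by (simp add: field_simps)
  qed (use D in \<open>auto intro: less_imp_le\<close>)
  also have "\<dots> = trace ((transpose G ** S ** G) ** D)"
    by (simp add: trace_mult_diagonal[OF D0] congruence_diagonal)
  also have "\<dots> = trace (S ** A)"
    unfolding AG using trace_mul_sym[of "transpose G" "S ** G ** D"]
    by (simp add: matrix_mul_assoc)
  finally show ?thesis .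
qed

text \<open>Cauchy-Schwarz for two unit vectors bounds a squared entry by the product of two
  diagonal entries. Hence a bound on the diagonal bounds the whole matrix.\<close>

lemma pos_semidef_offdiagonal_le:
  fixes A :: "real^'n^'n"
  assumes A: "pos_semidef A" and t: "\<And>k. A $ k $ k \<le> t"
  shows "\<bar>A $ i $ j\<bar> \<le> t"
proof -
  have "axis i 1 \<bullet> (A *v axis j 1) = A $ i $ j"
    by (simp add: matrix_vector_mult_basis inner_axis' column_def)
  then have "(A $ i $ j)\<^sup>2 \<le> A $ i $ i * A $ j $ j"
    using pos_semidef_Cauchy_Schwarz[OF A, of "axis i 1" "axis j 1"]
    by (simp add: quadratic_form_axis)
  also have "\<dots> \<le> t * t"
    using pos_semidef_diagonal[OF A] t by (intro mult_mono) (auto intro: order_trans)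
  finally have "(A $ i $ j)\<^sup>2 \<le> t\<^sup>2" by (simp add: power2_eq_square)
  moreover have "0 \<le> t" using pos_semidef_diagonal[OF A, of i] t[of i] by linarith
  ultimately show ?thesis by (metis abs_le_square_iff abs_of_nonneg)
qed

text \<open>The \<open>k\<close>-th diagonal term contributes at least
  \<open>2 * \<delta> * A $ k $ k\<close>, the other diagonal terms are nonnegative, and the
  off-diagonal terms take away at most half of that contribution.\<close>

lemma trace_mult_ge_diagonally_dominant:
  fixes S A :: "real^'n^'n"
  assumes S: "\<And>j. 2 * \<delta> \<le> S $ j $ j" and "0 \<le> \<delta>"
    and \<epsilon>: "\<epsilon> * (\<Sum>i\<in>UNIV. \<Sum>j\<in>UNIV. \<bar>S $ i $ j\<bar>) \<le> \<delta>" "0 \<le> \<epsilon>"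
    and A: "\<And>j. 0 \<le> A $ j $ j" "\<And>i j. i \<noteq> j \<Longrightarrow> \<bar>A $ i $ j\<bar> \<le> \<epsilon> * A $ k $ k"
  shows "\<delta> * A $ k $ k \<le> trace (S ** A)"
proof -
  let ?t = "A $ k $ k"
  \<comment> \<open>The loss is charged to diagonal entries as well, so that it sums to a multiple
    of the full sum of the \<open>\<bar>S $ i $ j\<bar>\<close>.\<close>
  have entry: "(if i = k then if j = k then 2 * \<delta> * ?t else 0 else 0) - \<epsilon> * ?t * \<bar>S $ i $ j\<bar>
      \<le> S $ i $ j * A $ j $ i" for i j
  proof (cases "i = j")
    case True
    have "0 \<le> \<epsilon> * ?t * \<bar>S $ i $ j\<bar>" using \<epsilon>(2) A(1) by simp
    moreover have "0 \<le> S $ i $ i * A $ i $ i"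
      using S[of i] \<open>0 \<le> \<delta>\<close> A(1)[of i] by (intro mult_nonneg_nonneg) auto
    moreover have "2 * \<delta> * ?t \<le> S $ k $ k * ?t" using S A(1) by (rule mult_right_mono)
    ultimately show ?thesis using True by auto
  next
    case False
    have "\<bar>S $ i $ j * A $ j $ i\<bar> \<le> \<bar>S $ i $ j\<bar> * (\<epsilon> * ?t)"
      unfolding abs_mult using A(2)[of j i] False by (intro mult_left_mono) auto
    then show ?thesis using False by (auto simp: mult_ac)
  qed
  have "\<delta> * ?t \<le> 2 * \<delta> * ?t - (\<epsilon> * (\<Sum>i\<in>UNIV. \<Sum>j\<in>UNIV. \<bar>S $ i $ j\<bar>)) * ?t"
    using mult_right_mono[OF \<epsilon>(1) A(1)[of k]] by simp
  also have "\<dots> = (\<Sum>i\<in>UNIV. \<Sum>j\<in>UNIV. (if i = k then if j = k then 2 * \<delta> * ?t else 0 else 0)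
      - \<epsilon> * ?t * \<bar>S $ i $ j\<bar>)"
  proof -
    have "(\<Sum>i\<in>UNIV. \<Sum>j\<in>UNIV. if i = k then if j = k then 2 * \<delta> * ?t else 0 else 0)
        = (\<Sum>i\<in>UNIV. if i = k then 2 * \<delta> * ?t else 0)"
      by (intro sum.cong) auto
    then show ?thesis by (simp add: sum_subtractf sum_distrib_left[symmetric] mult_ac)
  qed
  also have "\<dots> \<le> (\<Sum>i\<in>UNIV. \<Sum>j\<in>UNIV. S $ i $ j * A $ j $ i)"
    by (intro sum_mono entry)
  also have "\<dots> = trace (S ** A)" by (simp add: trace_def matrix_matrix_mult_def)
  finally show ?thesis .
qed

section \<open>Growth of the penalty and coercivity of the likelihood\<close>

lemma sum_offdiag_penalty_ge:
  fixes A :: "real^'n::{finite,linorder}^'n::{finite,linorder}"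
  assumes pen: "offdiag_penalty pen" and A: "symmetric_matrix A" and "a \<noteq> b"
  shows "pen (A $ a $ b) \<le> (\<Sum>(i, j) | i < j. pen (A $ i $ j))"
proof -
  have *: "pen (A $ i $ j) \<le> (\<Sum>(i, j) | i < j. pen (A $ i $ j))" if "i < j" for i j
    using member_le_sum[of "(i, j)" "{(i, j). i < j}" "\<lambda>(i, j). pen (A $ i $ j)"] that pen
    by (auto simp: offdiag_penalty_def)
  show ?thesis
    using *[of a b] *[of b a] \<open>a \<noteq> b\<close> symmetric_matrix_nth[OF A, of a b] by (cases a b rule: linorder_cases) auto
qed

lemma sum_offdiag_penalty_nonneg:
  "offdiag_penalty pen \<Longrightarrow> 0 \<le> (\<Sum>(i, j) | i < j. pen (A $ i $ j))"
  by (intro sum_nonneg) (auto simp: offdiag_penalty_def)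

lemma Liminf_log_imp_ge:
  fixes pen :: "real \<Rightarrow> real"
  assumes "Liminf at_infinity (\<lambda>x::real. ereal (pen x / ln \<bar>x\<bar>)) > ereal r"
  obtains c M where "r < c" "\<And>x. M \<le> x \<Longrightarrow> c * ln x \<le> pen x"
proof -
  obtain c where c: "ereal r < ereal c"
    "ereal c < Liminf at_infinity (\<lambda>x::real. ereal (pen x / ln \<bar>x\<bar>))"
    using ereal_dense2[OF assms] by auto
  have "\<forall>\<^sub>F x in at_infinity. ereal c < ereal (pen x / ln \<bar>x\<bar>)"
    using less_LiminfD[OF c(2)] .
  then obtain b where b: "\<And>x. b \<le> norm x \<Longrightarrow> c < pen x / ln \<bar>x\<bar>"
    by (auto simp: eventually_at_infinity)
  \<comment> \<open>The bound 2 keeps \<open>ln x\<close> positive, so that the quotient can be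
    cleared.\<close>
  have "c * ln x \<le> pen x" if "max b 2 \<le> x" for x
  proof -
    have "0 < ln x" using that by simp
    then show ?thesis using b[of x] that by (simp add: field_simps)
  qed
  then show ?thesis using c(1) that[of c "max b 2"] by simp
qed

lemma l_Pen_coercive:
  fixes S :: "real^'n::{finite,linorder}^'n::{finite,linorder}"
  assumes S: "pos_semidef S" and diag: "\<And>i. 0 < S $ i $ i"
    and pen: "offdiag_penalty pen"
    and lim: "Liminf at_infinity (\<lambda>x::real. ereal (pen x / ln \<bar>x\<bar>)) > ereal (real CARD('n) - 1)"
  obtains T where "\<And>\<Theta> k. pos_def \<Theta> \<Longrightarrow> T \<le> \<Theta> $ k $ k \<Longrightarrow> l_Pen (\<lambda>_. 0) pen S \<Theta> < L"
proof -
  let ?p = "real CARD('n)"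
  obtain c M where c: "?p - 1 < c" and M: "\<And>x. M \<le> x \<Longrightarrow> c * ln x \<le> pen x"
    using Liminf_log_imp_ge[OF lim] by blast
  define \<delta> where "\<delta> = Min (range (\<lambda>k. S $ k $ k)) / 2"
  have "Min (range (\<lambda>k. S $ k $ k)) \<in> range (\<lambda>k. S $ k $ k)" by (intro Min_in) auto
  then have \<delta>: "0 < \<delta>" using diag unfolding \<delta>_def by auto
  have S\<delta>: "2 * \<delta> \<le> S $ k $ k" for k
    unfolding \<delta>_def by simp
  define \<sigma> where "\<sigma> = (\<Sum>i\<in>UNIV. \<Sum>j\<in>UNIV. \<bar>S $ i $ j\<bar>)"
  have "0 \<le> \<sigma>" unfolding \<sigma>_def by (intro sum_nonneg) auto
  \<comment> \<open>The \<open>+ 1\<close> keeps the denominator positive, given only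
    \<open>0 \<le> \<sigma>\<close>.\<close>
  define \<epsilon> where "\<epsilon> = \<delta> / (\<sigma> + 1)"
  have \<epsilon>: "0 < \<epsilon>" "\<epsilon> * \<sigma> \<le> \<delta>"
    using \<delta> \<open>0 \<le> \<sigma>\<close> by (auto simp: \<epsilon>_def field_simps)
  \<comment> \<open>Any index will do, since every diagonal entry of \<open>S\<close> is
    positive.\<close>
  define i :: 'n where "i = undefined"
  \<comment> \<open>The constants left over in the second case: \<open>- 2 * ln (S $ i $ i)\<close>
    from the determinant, \<open>ln (S $ i $ i) - 1\<close> from the bound on
    \<open>ln q - q / S $ i $ i\<close>, and \<open>- c * ln \<epsilon>\<close> from the
    penalty.\<close>
  define K where "K = - 1 - ln (S $ i $ i) - c * ln \<epsilon>"
  have "\<forall>\<^sub>F t in at_top. ?p * ln t - \<delta> * t < L"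
    using \<delta> by real_asymp
  moreover have "\<forall>\<^sub>F t in at_top. K - (c - (?p - 1)) * ln t < L"
  proof -
    have "0 < c - (?p - 1)" using c by simp
    then show ?thesis by real_asymp
  qed
  moreover have "\<forall>\<^sub>F t in at_top. M \<le> \<epsilon> * t"
    using \<epsilon> by real_asymp
  ultimately have "\<forall>\<^sub>F t in at_top. ?p * ln t - \<delta> * t < L \<and> K - (c - (?p - 1)) * ln t < L \<and> M \<le> \<epsilon> * t"
    by (intro eventually_conj)
  then obtain T where T: "\<And>t. T \<le> t \<Longrightarrow> ?p * ln t - \<delta> * t < L"
    "\<And>t. T \<le> t \<Longrightarrow> K - (c - (?p - 1)) * ln t < L" "\<And>t. T \<le> t \<Longrightarrow> M \<le> \<epsilon> * t"
    by (auto simp: eventually_at_top_linorder)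
  have "l_Pen (\<lambda>_. 0) pen S \<Theta> < L" if \<Theta>: "pos_def \<Theta>" and large: "T \<le> \<Theta> $ k0 $ k0" for \<Theta> k0
  proof -
    have "Max (range (\<lambda>k. \<Theta> $ k $ k)) \<in> range (\<lambda>k. \<Theta> $ k $ k)" by (intro Max_in) auto
    then obtain k where k: "\<Theta> $ k $ k = Max (range (\<lambda>k. \<Theta> $ k $ k))"
      by (metis (no_types, lifting) imageE)
    define t where "t = \<Theta> $ k $ k"
    have le_t: "\<Theta> $ j $ j \<le> t" for j unfolding t_def k by simp
    have "T \<le> t" using large le_t[of k0] by linarith
    have pos: "0 < \<Theta> $ j $ j" for j using pos_def_diagonal[OF \<Theta>] .
    then have t: "0 < t" unfolding t_def .
    have prod_le: "(\<Prod>j\<in>J. \<Theta> $ j $ j) \<le> t ^ card J" for J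
      using prod_mono[of J "\<lambda>j. \<Theta> $ j $ j" "\<lambda>_. t"] pos le_t by (auto intro: less_imp_le)
    have det: "0 < det \<Theta>" using pos_def_det_pos[OF \<Theta>] .
    have l: "l_Pen (\<lambda>_. 0) pen S \<Theta> =
        ln (det \<Theta>) - trace (S ** \<Theta>) - (\<Sum>(i, j) | i < j. pen (\<Theta> $ i $ j))"
      by (simp add: l_Pen_def Pen_def)
    show ?thesis
    proof (cases "\<forall>a b. a \<noteq> b \<longrightarrow> \<bar>\<Theta> $ a $ b\<bar> \<le> \<epsilon> * t")
      case True
      have "\<delta> * t \<le> trace (S ** \<Theta>)"
        unfolding t_def
        using S\<delta> \<delta> \<epsilon> pos True
        by (intro trace_mult_ge_diagonally_dominant[of \<delta> S \<epsilon>]) (auto simp: \<sigma>_def t_def intro: less_imp_le)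
      moreover have "ln (det \<Theta>) \<le> ?p * ln t"
      proof -
        have "det \<Theta> \<le> t ^ CARD('n)"
          using pos_def_Hadamard[OF \<Theta>] prod_le[of UNIV] by linarith
        then have "ln (det \<Theta>) \<le> ln (t ^ CARD('n))" using det t by (subst ln_le_cancel_iff) auto
        then show ?thesis using t by (simp add: ln_realpow)
      qed
      ultimately show ?thesis
        using T(1)[OF \<open>T \<le> t\<close>] sum_offdiag_penalty_nonneg[OF pen, of \<Theta>] unfolding l by linarith
    next
      case False
      then obtain a b where ab: "a \<noteq> b" "\<epsilon> * t < \<bar>\<Theta> $ a $ b\<bar>" by force
      have "c * ln (\<epsilon> * t) \<le> pen (\<epsilon> * t)" using M T(3)[OF \<open>T \<le> t\<close>] by blast
      also have "\<dots> \<le> pen (\<Theta> $ a $ b)"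
        using pen ab(2) \<epsilon>(1) t by (auto simp: offdiag_penalty_def)
      also have "\<dots> \<le> (\<Sum>(i, j) | i < j. pen (\<Theta> $ i $ j))"
        using sum_offdiag_penalty_ge[OF pen _ ab(1)] \<Theta> unfolding pos_def_def by blast
      finally have P: "c * ln \<epsilon> + c * ln t \<le> (\<Sum>(i, j) | i < j. pen (\<Theta> $ i $ j))"
        using \<epsilon>(1) t by (simp add: ln_mult distrib_left)
      define s where "s = column i S"
      have si: "s $ i = S $ i $ i" by (simp add: s_def column_def)
      then have "s \<noteq> 0" using diag[of i] by auto
      define q where "q = s \<bullet> (\<Theta> *v s)"
      have q: "0 < q" using \<Theta> \<open>s \<noteq> 0\<close> unfolding q_def pos_def_def by blast
      have tr: "q / S $ i $ i \<le> trace (S ** \<Theta>)"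
        using trace_mult_ge_column[OF S \<Theta> diag[of i]] unfolding q_def s_def .
      \<comment> \<open>The factor \<open>q\<close> may grow with \<open>t\<close>, but the trace
        pays for it: \<open>ln q - q / S $ i $ i\<close> is largest at
        \<open>q = S $ i $ i\<close>.\<close>
      have lnq: "ln q - q / S $ i $ i \<le> ln (S $ i $ i) - 1"
        using ln_le_minus_one[of "q / S $ i $ i"] q diag[of i] by (simp add: ln_div)
      have "(S $ i $ i)\<^sup>2 * det \<Theta> \<le> q * (\<Prod>j\<in>UNIV - {i}. \<Theta> $ j $ j)"
        using pos_def_det_le_replace[OF \<Theta>, of s i] diag[of i] by (simp add: si q_def)
      also have "\<dots> \<le> q * t ^ (CARD('n) - 1)"
        using prod_le[of "UNIV - {i}"] q by (simp add: card_Diff_singleton)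
      finally have "ln ((S $ i $ i)\<^sup>2 * det \<Theta>) \<le> ln (q * t ^ (CARD('n) - 1))"
        using det t q diag[of i] by (subst ln_le_cancel_iff) auto
      moreover have "ln ((S $ i $ i)\<^sup>2 * det \<Theta>) = 2 * ln (S $ i $ i) + ln (det \<Theta>)"
        using det diag[of i] by (simp add: ln_mult ln_realpow)
      moreover have "ln (q * t ^ (CARD('n) - 1)) = ln q + (?p - 1) * ln t"
        using q t by (simp add: ln_mult ln_realpow of_nat_diff Suc_leI)
      ultimately have "2 * ln (S $ i $ i) + ln (det \<Theta>) \<le> ln q + (?p - 1) * ln t" by simp
      then have "l_Pen (\<lambda>_. 0) pen S \<Theta> \<le> K - (c - (?p - 1)) * ln t"
        using P tr lnq unfolding l K_def by (simp add: algebra_simps)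
      then show ?thesis using T(2)[OF \<open>T \<le> t\<close>] by linarith
    qed
  qed
  then show ?thesis using that by blast
qed

section \<open>Compactness and existence of a maximiser\<close>

lemma continuous_on_det [continuous_intros]:
  fixes f :: "'a::topological_space \<Rightarrow> real^'n^'n"
  shows "continuous_on X f \<Longrightarrow> continuous_on X (\<lambda>x. det (f x))"
  unfolding det_def by (intro continuous_intros)

lemma closed_pos_semidef: "closed {A :: real^'n^'n. pos_semidef A}"
proof -
  \<comment> \<open>In terms of entries this is an intersection of closed conditions, each
    continuous in \<open>A\<close>.\<close>
  have "pos_semidef A \<longleftrightarrow> (\<forall>i j. A $ i $ j = A $ j $ i) \<and>
      (\<forall>x. 0 \<le> (\<Sum>i\<in>UNIV. x $ i * (\<Sum>j\<in>UNIV. A $ i $ j * x $ j)))" for A :: "real^'n^'n"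
    unfolding pos_semidef_def symmetric_matrix_def
    by (auto simp: vec_eq_iff transpose_def inner_vec_def matrix_vector_mult_def)
  then show ?thesis
    by (auto intro!: closed_Collect_conj closed_Collect_all closed_Collect_eq closed_Collect_le
        continuous_intros)
qed

lemma norm_matrix_le:
  fixes A :: "real^'n^'m"
  assumes "\<And>i j. \<bar>A $ i $ j\<bar> \<le> t"
  shows "norm A \<le> real CARD('m) * (real CARD('n) * t)"
proof -
  have "norm A \<le> (\<Sum>i\<in>UNIV. norm (A $ i))"
    unfolding norm_vec_def by (intro L2_set_le_sum) auto
  also have "\<dots> \<le> (\<Sum>i\<in>(UNIV :: 'm set). real CARD('n) * t)"
  proof (intro sum_mono)
    fix i
    have "norm (A $ i) \<le> (\<Sum>j\<in>UNIV. \<bar>A $ i $ j\<bar>)" by (rule norm_le_l1_cart)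
    also have "\<dots> \<le> (\<Sum>j\<in>(UNIV :: 'n set). t)" by (intro sum_mono assms)
    finally show "norm (A $ i) \<le> real CARD('n) * t" by simp
  qed
  finally show ?thesis by simp
qed

lemma pos_def_mat_1: "pos_def (mat 1 :: real^'n^'n)"
  by (simp add: pos_def_def symmetric_matrix_def)

lemma l_Pen_attains_max:
  fixes S :: "real^'n::{finite,linorder}^'n::{finite,linorder}"
  assumes S: "pos_semidef S" and diag: "\<And>i. 0 < S $ i $ i"
    and pen: "offdiag_penalty pen"
    and lim: "Liminf at_infinity (\<lambda>x::real. ereal (pen x / ln \<bar>x\<bar>)) > ereal (real CARD('n) - 1)"
  obtains \<Theta> where "pos_def \<Theta>"
    "\<And>A. pos_def A \<Longrightarrow> l_Pen (\<lambda>_. 0) pen S A \<le> l_Pen (\<lambda>_. 0) pen S \<Theta>"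
proof -
  let ?f = "l_Pen (\<lambda>_. 0) pen S"
  define L where "L = ?f (mat 1)"
  obtain T where T: "\<And>\<Theta> k. pos_def \<Theta> \<Longrightarrow> T \<le> \<Theta> $ k $ k \<Longrightarrow> ?f \<Theta> < L"
    using l_Pen_coercive[OF S diag pen lim] by metis
  \<comment> \<open>The positive definite matrices do not form a closed set. \<open>C\<close> is a
    closed part of them on which \<open>ln (det A)\<close> is continuous, and it contains every
    positive definite matrix with value at least \<open>L\<close>.\<close>
  define C :: "(real^'n::{finite,linorder}^'n::{finite,linorder}) set" where "C = {A. pos_semidef A} \<inter> {A. exp L \<le> det A}"
  have C_pd: "pos_def A" if "A \<in> C" for A
  proof (rule pos_semidef_imp_pos_def)
    show "pos_semidef A" using that by (simp add: C_def)
    have "0 < exp L" by simp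
    then show "det A \<noteq> 0" using that by (auto simp: C_def)
  qed
  have "closed C"
    unfolding C_def by (intro closed_Int closed_pos_semidef closed_Collect_le continuous_intros)
  have "continuous_on C ?f"
  proof -
    have "continuous_on C (\<lambda>A. pen (A $ i $ j))" for i j
    proof (rule continuous_on_compose2[of UNIV pen])
      show "continuous_on UNIV pen" using pen by (simp add: offdiag_penalty_def)
    qed (auto intro!: continuous_intros)
    moreover have "det A \<noteq> 0" if "A \<in> C" for A
      using pos_def_det_pos[OF C_pd[OF that]] by simp
    ultimately show ?thesis
      unfolding l_Pen_def Pen_def trace_def matrix_matrix_mult_def case_prod_unfold
      by (auto intro!: continuous_intros)
  qed
  define K where "K = C \<inter> ?f -` {L..}"
  have "closed K"
    unfolding K_def using \<open>continuous_on C ?f\<close> \<open>closed C\<close> by (intro continuous_closed_preimage) auto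
  moreover have "bounded K"
  proof (rule boundedI)
    fix A assume "A \<in> K"
    then have A: "pos_def A" "L \<le> ?f A" using C_pd by (auto simp: K_def)
    then have "A $ k $ k \<le> T" for k using T[of A k] by force
    then show "norm A \<le> real CARD('n) * (real CARD('n) * T)"
      using pos_semidef_offdiagonal_le[OF pos_def_imp_pos_semidef[OF A(1)]] by (intro norm_matrix_le) blast
  qed
  ultimately have "compact K" by (simp add: compact_eq_bounded_closed)
  \<comment> \<open>Trace and penalty are nonnegative, so a value of at least \<open>L\<close>
    forces \<open>L \<le> ln (det A)\<close>.\<close>
  have KI: "A \<in> K" if A: "pos_def A" "L \<le> ?f A" for A
  proof -
    fix i :: 'n
    have "0 \<le> column i S \<bullet> (A *v column i S)"
      using pos_def_imp_pos_semidef[OF A(1)] unfolding pos_semidef_def by blast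
    then have "0 \<le> trace (S ** A)"
      using trace_mult_ge_column[OF S A(1) diag] diag[of i] by (meson divide_nonneg_pos order_trans)
    then have "L \<le> ln (det A)"
      using A(2) sum_offdiag_penalty_nonneg[OF pen, of A] by (simp add: l_Pen_def Pen_def)
    then have "exp L \<le> det A" using pos_def_det_pos[OF A(1)] by (simp add: ln_ge_iff)
    then show ?thesis using A pos_def_imp_pos_semidef by (auto simp: K_def C_def)
  qed
  have "K \<noteq> {}" using KI[OF pos_def_mat_1] by (auto simp: L_def)
  moreover have "continuous_on K ?f"
    using \<open>continuous_on C ?f\<close> by (rule continuous_on_subset) (auto simp: K_def)
  ultimately obtain \<Theta> where \<Theta>: "\<Theta> \<in> K" "\<And>A. A \<in> K \<Longrightarrow> ?f A \<le> ?f \<Theta>"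
    using continuous_attains_sup[OF \<open>compact K\<close>] by metis
  \<comment> \<open>Outside \<open>K\<close> the value is below \<open>L\<close>, and
    \<open>\<Theta>\<close> has value at least \<open>L\<close>.\<close>
  have "?f A \<le> ?f \<Theta>" if "pos_def A" for A
    using KI[OF that] \<Theta> by (cases "L \<le> ?f A") (auto simp: K_def)
  moreover have "pos_def \<Theta>" using \<Theta>(1) C_pd by (simp add: K_def)
  ultimately show ?thesis using that by blast
qed

section \<open>Unboundedness when a diagonal entry of \<open>S\<close> vanishes\<close>

lemma l_Pen_unbounded:
  fixes S :: "real^'n::{finite,linorder}^'n::{finite,linorder}"
  assumes "S $ i $ i = 0"
  shows "\<not> bdd_above (l_Pen (\<lambda>_. 0) pen S ` {\<Theta>. pos_def \<Theta>})"
proof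
  assume "bdd_above (l_Pen (\<lambda>_. 0) pen S ` {\<Theta>. pos_def \<Theta>})"
  then obtain B where B: "\<And>\<Theta>. pos_def \<Theta> \<Longrightarrow> l_Pen (\<lambda>_. 0) pen S \<Theta> \<le> B"
    by (auto simp: bdd_above_def)
  \<comment> \<open>Along this family the determinant is \<open>t\<close>, while the trace does not
    see \<open>t\<close> because \<open>S $ i $ i = 0\<close>, and the penalty sees only zeros off
    the diagonal.\<close>
  define D :: "real \<Rightarrow> real^'n::{finite,linorder}^'n::{finite,linorder}" where
    "D t = (\<chi> a b. if a = b then if a = i then t else 1 else 0)" for t
  have off: "a \<noteq> b \<Longrightarrow> D t $ a $ b = 0" for a b t by (simp add: D_def)
  have pd: "pos_def (D t)" if "0 < t" for t
  proof -
    have "0 < x \<bullet> (D t *v x)" if "x \<noteq> 0" for x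
    proof -
      obtain k where "x $ k \<noteq> 0" using \<open>x \<noteq> 0\<close> by (auto simp: vec_eq_iff)
      then show ?thesis
        unfolding inner_diagonal[of "D t", OF off, simplified]
        using \<open>0 < t\<close> by (intro sum_pos2[of _ k]) (auto simp: D_def)
    qed
    then show ?thesis by (auto simp: pos_def_def symmetric_matrix_def transpose_def vec_eq_iff D_def)
  qed
  have det: "det (D t) = t" for t
  proof -
    have "det (D t) = (\<Prod>k\<in>UNIV. if k = i then t else 1)"
      by (subst det_diagonal) (auto simp: D_def intro!: prod.cong)
    then show ?thesis by simp
  qed
  have tr: "trace (S ** D t) = (\<Sum>k\<in>UNIV. S $ k $ k)" for t
    unfolding trace_mult_diagonal[of "D t" S, OF off, simplified]
    using assms by (intro sum.cong) (auto simp: D_def)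
  have pn: "Pen (\<lambda>_. 0) pen (D t) = (\<Sum>(i, j) | i < (j::'n). pen 0)" for t
    unfolding Pen_def by (auto simp: D_def intro!: sum.cong simp del: sum_constant)
  define R where "R = (\<Sum>k\<in>UNIV. S $ k $ k) + (\<Sum>(i, j) | i < (j::'n). pen 0)"
  have "ln t \<le> B + R" if "0 < t" for t
    using B[OF pd[OF that]] by (simp add: l_Pen_def det tr pn R_def)
  from this[of "exp (B + R + 1)"] show False by simp
qed

section \<open>The equivalence\<close>

theorem corollary4:
  fixes S :: "real^'n::{finite,linorder}^'n::{finite,linorder}"
    and pen penD :: "real \<Rightarrow> real"
  assumes "pos_semidef S"
    and "offdiag_penalty pen"
    and "\<And>x. x > 0 \<Longrightarrow> penD x = 0"
    and "Liminf at_infinity (\<lambda>x::real. ereal (pen x / ln \<bar>x\<bar>)) > ereal (real CARD('n) - 1)"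
  shows "penalised_estimate_exists penD pen S \<longleftrightarrow> (\<forall>i. S $ i $ i > 0)"
proof -
  \<comment> \<open>\<open>penD\<close> is known to vanish only at positive arguments, so the two
    likelihoods are identified only on positive definite matrices, whose diagonals are
    positive.\<close>
  have l0: "l_Pen penD pen S \<Theta> = l_Pen (\<lambda>_. 0) pen S \<Theta>" if "pos_def \<Theta>" for \<Theta>
    using assms(3) pos_def_diagonal[OF that] by (simp add: l_Pen_def Pen_def)
  then have img: "l_Pen penD pen S ` {\<Theta>. pos_def \<Theta>} = l_Pen (\<lambda>_. 0) pen S ` {\<Theta>. pos_def \<Theta>}"
    by (intro image_cong) auto
  show ?thesis
  proof
    assume "penalised_estimate_exists penD pen S"
    then have "bdd_above (l_Pen (\<lambda>_. 0) pen S ` {\<Theta>. pos_def \<Theta>})"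
      unfolding penalised_estimate_exists_def img by (rule conjunct1)
    then have "S $ i $ i \<noteq> 0" for i using l_Pen_unbounded by blast
    then show "\<forall>i. S $ i $ i > 0"
      using pos_semidef_diagonal[OF assms(1)] by (metis less_eq_real_def)
  next
    assume "\<forall>i. S $ i $ i > 0"
    then obtain \<Theta> where \<Theta>: "pos_def \<Theta>"
      "\<And>A. pos_def A \<Longrightarrow> l_Pen (\<lambda>_. 0) pen S A \<le> l_Pen (\<lambda>_. 0) pen S \<Theta>"
      using l_Pen_attains_max[OF assms(1) _ assms(2,4)] by metis
    have "(SUP \<Theta>'\<in>{\<Theta>. pos_def \<Theta>}. l_Pen (\<lambda>_. 0) pen S \<Theta>') = l_Pen (\<lambda>_. 0) pen S \<Theta>"
      using \<Theta> by (intro cSup_eq_maximum) auto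
    then show "penalised_estimate_exists penD pen S"
      unfolding penalised_estimate_exists_def img using \<Theta> l0[OF \<Theta>(1)] by (auto intro!: bdd_aboveI2)
  qed
qed

end
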